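(* In the case where the uncertainty set $\mathcal V$ is defined only by linear constraints, i.e. $\mathcal V=\{v\in\mathbb R^{nm}: Qv\succeq e,\ v\succeq0\}$, the robust group egalitarian welfare problem $$\max_{a\in\mathcal A}\ \min_{v\in\mathcal V}\ \min_{G\in\mathcal G}\ u_G(a,v)$$ transforms into a linear program.
   Context: There are $n$ agents $N$, partitioned into $g$ groups $\mathcal G=\{G_1,\dots,G_g\}$, and $m$ item types $I$. Allocations and valuations are $n\times m$ matrices, vectorized in row-major order as $a,v\in\mathbb R^{nm}$; $x_G\in\mathbb R^{|G|m}$ is the restriction of a vector $x$ to the agents in $G$; $a_{j,i}$ is the entry of $a$ for agent $j$ and item $i$. $\succeq,\preceq$ are coordinatewise; $Q$ is a real matrix with $nm$ columns and $e$ a real vector of matching length. The set of feasible (continuous) allocations $\mathcal A$ consists of all $a\in\mathbb R_{\ge0}^{nm}$ with $\underline\kappa_j\le\sum_{i\in I}a_{j,i}\le\bar\kappa_j$ for each agent $j$, $\underline\psi_i\le\sum_{j\in N}a_{j,i}\le\bar\psi_i$ for each item $i$, and $a\preceq c$, for given bounds $\underline\kappa,\bar\kappa,\underline\psi,\bar\psi,c$. The factor $1/|G|$ in the group utility is absorbed into the valuations and the uncertainty set, so $u_G(a,v)=a_G^\top v_G$. Uncertainty sets of different groups are assumed independent: $\mathcal V=\prod_{G\in\mathcal G}\mathcal V_G$ is the Cartesian product of individual groups' uncertainty sets $\mathcal V_G\subseteq\mathbb R^{|G|m}$. *)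

theory Defs
  imports "HOL-Analysis.Analysis"
begin

text \<open>
  Agents, item types and groups are the elements of finite types \<open>'n\<close>, \<open>'m\<close> and \<open>'g\<close>; the group
  \<open>g\<close> has the set of members \<open>G g\<close>. A vectorized allocation or valuation is indexed by pairs
  (agent, item). On vectors, \<open>\<le>\<close> is the coordinatewise order.
\<close>

definition grouping :: "('g::finite \<Rightarrow> 'n::finite set) \<Rightarrow> bool" where
  "grouping G \<longleftrightarrow> (\<forall>g. G g \<noteq> {}) \<and> disjoint_family G \<and> (\<Union>g. G g) = UNIV"

definition feasible_allocations ::
    "real^'n \<Rightarrow> real^'n \<Rightarrow> real^'m \<Rightarrow> real^'m \<Rightarrow> real^('n \<times> 'm) \<Rightarrow> (real^('n::finite \<times> 'm::finite)) set"
  where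
  "feasible_allocations \<kappa>l \<kappa>u \<psi>l \<psi>u cap =
     {a. 0 \<le> a
       \<and> (\<forall>j. \<kappa>l $ j \<le> (\<Sum>i\<in>UNIV. a $ (j, i)) \<and> (\<Sum>i\<in>UNIV. a $ (j, i)) \<le> \<kappa>u $ j)
       \<and> (\<forall>i. \<psi>l $ i \<le> (\<Sum>j\<in>UNIV. a $ (j, i)) \<and> (\<Sum>j\<in>UNIV. a $ (j, i)) \<le> \<psi>u $ i)
       \<and> a \<le> cap}"

text \<open>The restriction \<open>x\<^sub>S\<close> of a vector to the agents in \<open>S\<close>, as an extensional function.\<close>

definition block :: "'n set \<Rightarrow> real^('n::finite \<times> 'm::finite) \<Rightarrow> 'n \<times> 'm \<Rightarrow> real" where
  "block S x = restrict (\<lambda>p. x $ p) (S \<times> UNIV)"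

text \<open>The factor \<open>1/|S|\<close> is absorbed into the valuations.\<close>

definition group_utility ::
    "'n set \<Rightarrow> real^('n \<times> 'm) \<Rightarrow> real^('n::finite \<times> 'm::finite) \<Rightarrow> real" where
  "group_utility S a v = (\<Sum>p\<in>S \<times> UNIV. block S a p * block S v p)"

definition product_of_groups ::
    "('g::finite \<Rightarrow> 'n set) \<Rightarrow> ('g \<Rightarrow> ('n \<times> 'm \<Rightarrow> real) set) \<Rightarrow> (real^('n::finite \<times> 'm::finite)) set"
  where
  "product_of_groups G VG = {v. \<forall>g. block (G g) v \<in> VG g}"

definition linear_uncertainty_set ::
    "real^('n \<times> 'm)^'k \<Rightarrow> real^'k::finite \<Rightarrow> (real^('n::finite \<times> 'm::finite)) set" where
  "linear_uncertainty_set Q e = {v. e \<le> Q *v v \<and> 0 \<le> v}"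


subsection \<open>The robust problem\<close>

text \<open>Values are extended reals: a minimum over the empty set is \<open>\<infinity>\<close>, a maximum \<open>-\<infinity>\<close>.\<close>

definition worst_case_welfare ::
    "('g::finite \<Rightarrow> 'n set) \<Rightarrow> (real^('n \<times> 'm)) set \<Rightarrow> real^('n::finite \<times> 'm::finite) \<Rightarrow> ereal" where
  "worst_case_welfare G V a = (INF v\<in>V. INF g. ereal (group_utility (G g) a v))"

definition robust_value ::
    "('g::finite \<Rightarrow> 'n set) \<Rightarrow> (real^('n \<times> 'm)) set \<Rightarrow> (real^('n::finite \<times> 'm::finite)) set \<Rightarrow> ereal"
  where
  "robust_value G V A = (SUP a\<in>A. worst_case_welfare G V a)"

definition robust_optimal ::
    "('g::finite \<Rightarrow> 'n set) \<Rightarrow> (real^('n \<times> 'm)) set \<Rightarrow> (real^('n::finite \<times> 'm::finite)) set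
      \<Rightarrow> real^('n \<times> 'm) \<Rightarrow> bool" where
  "robust_optimal G V A a \<longleftrightarrow>
     a \<in> A \<and> (\<forall>a'\<in>A. worst_case_welfare G V a' \<le> worst_case_welfare G V a)"


subsection \<open>Linear programs: maximize \<open>c \<bullet> x\<close> subject to \<open>M *v x \<le> b\<close>\<close>

definition lp_feasible :: "real^'x^'r \<Rightarrow> real^'r \<Rightarrow> (real^'x::finite) set" where
  "lp_feasible M b = {x. M *v x \<le> b}"

definition lp_value :: "real^'x \<Rightarrow> real^'x^'r \<Rightarrow> real^'r \<Rightarrow> ereal" where
  "lp_value c M b = (SUP x\<in>lp_feasible M b. ereal (c \<bullet> x))"

definition lp_optimal :: "real^'x \<Rightarrow> real^'x^'r \<Rightarrow> real^'r \<Rightarrow> real^'x \<Rightarrow> bool" where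
  "lp_optimal c M b x \<longleftrightarrow> x \<in> lp_feasible M b \<and> (\<forall>x'\<in>lp_feasible M b. c \<bullet> x' \<le> c \<bullet> x)"


subsection \<open>The linear program of the robust problem\<close>

text \<open>
  By linear programming duality, for each group the minimum of \<open>a\<^sub>G \<bullet> v\<^sub>G\<close> over \<open>Q v \<ge> e\<close>, \<open>v \<ge> 0\<close>
  is the maximum of \<open>e \<bullet> y\<close> over \<open>y \<ge> 0\<close> with \<open>Q\<^sup>T y \<le> a'\<close>, where \<open>a'\<close> is \<open>a\<close> on the
  coordinates of \<open>G\<close> and 0 elsewhere. With a dual vector \<open>y g\<close> for each group and a bound \<open>t\<close>
  on all group utilities, the robust problem becomes:

    maximize \<open>t\<close> over \<open>(a, t, y)\<close> subject to \<open>a\<close> being a feasible allocation and, for all \<open>g\<close>,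
    \<open>t \<le> e \<bullet> y g\<close>, \<open>Q\<^sup>T y g \<le> a'\<close> (for \<open>G g\<close>), \<open>y g \<ge> 0\<close>.

  The two datatypes index the variables (\<open>'p = 'n \<times> 'm\<close>) and the inequalities of this program.
\<close>

datatype ('p, 'g, 'k) lp_var = Alloc 'p | Level | Dual 'g 'k

datatype ('n, 'm, 'g, 'k) lp_row =
    AllocNonneg "'n \<times> 'm" | AllocCap "'n \<times> 'm"
  | AgentLower 'n | AgentUpper 'n | ItemLower 'm | ItemUpper 'm
  | GroupLevel 'g | DualFeasible 'g "'n \<times> 'm" | DualNonneg 'g 'k

instance lp_var :: (finite, finite, finite) finite
proof
  have "(UNIV :: ('a, 'b, 'c) lp_var set) = range Alloc \<union> {Level} \<union> range (case_prod Dual)"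
    by (auto simp: image_iff) (metis lp_var.exhaust)
  then show "finite (UNIV :: ('a, 'b, 'c) lp_var set)"
    by (metis finite finite.emptyI finite_Un finite_imageI finite_insert)
qed

instance lp_row :: (finite, finite, finite, finite) finite
proof
  have "(UNIV :: ('a, 'b, 'c, 'd) lp_row set) =
      range AllocNonneg \<union> range AllocCap \<union> range AgentLower \<union> range AgentUpper \<union>
      range ItemLower \<union> range ItemUpper \<union> range GroupLevel \<union>
      range (case_prod DualFeasible) \<union> range (case_prod DualNonneg)"
    by (auto simp: image_iff) (metis lp_row.exhaust surj_pair)
  then show "finite (UNIV :: ('a, 'b, 'c, 'd) lp_row set)"
    by (metis finite finite_Un finite_imageI)
qed

fun robust_lp_coeff ::
    "('g \<Rightarrow> 'n set) \<Rightarrow> real^('n \<times> 'm)^'k \<Rightarrow> real^'k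
      \<Rightarrow> ('n::finite, 'm::finite, 'g::finite, 'k::finite) lp_row
      \<Rightarrow> ('n \<times> 'm, 'g, 'k) lp_var \<Rightarrow> real" where
  "robust_lp_coeff G Q e (AllocNonneg p) x = - of_bool (x = Alloc p)"
| "robust_lp_coeff G Q e (AllocCap p) x = of_bool (x = Alloc p)"
| "robust_lp_coeff G Q e (AgentLower j) x = - of_bool (\<exists>i. x = Alloc (j, i))"
| "robust_lp_coeff G Q e (AgentUpper j) x = of_bool (\<exists>i. x = Alloc (j, i))"
| "robust_lp_coeff G Q e (ItemLower i) x = - of_bool (\<exists>j. x = Alloc (j, i))"
| "robust_lp_coeff G Q e (ItemUpper i) x = of_bool (\<exists>j. x = Alloc (j, i))"
| "robust_lp_coeff G Q e (GroupLevel g) x =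
     (case x of Alloc _ \<Rightarrow> 0 | Level \<Rightarrow> 1 | Dual g' k \<Rightarrow> - of_bool (g' = g) * e $ k)"
| "robust_lp_coeff G Q e (DualFeasible g p) x =
     (case x of Alloc q \<Rightarrow> - of_bool (q = p \<and> fst p \<in> G g) | Level \<Rightarrow> 0
        | Dual g' k \<Rightarrow> of_bool (g' = g) * Q $ k $ p)"
| "robust_lp_coeff G Q e (DualNonneg g k) x = - of_bool (x = Dual g k)"

fun robust_lp_bound ::
    "real^'n \<Rightarrow> real^'n \<Rightarrow> real^'m \<Rightarrow> real^'m \<Rightarrow> real^('n \<times> 'm)
      \<Rightarrow> ('n::finite, 'm::finite, 'g, 'k) lp_row \<Rightarrow> real" where
  "robust_lp_bound \<kappa>l \<kappa>u \<psi>l \<psi>u cap (AllocNonneg p) = 0"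
| "robust_lp_bound \<kappa>l \<kappa>u \<psi>l \<psi>u cap (AllocCap p) = cap $ p"
| "robust_lp_bound \<kappa>l \<kappa>u \<psi>l \<psi>u cap (AgentLower j) = - \<kappa>l $ j"
| "robust_lp_bound \<kappa>l \<kappa>u \<psi>l \<psi>u cap (AgentUpper j) = \<kappa>u $ j"
| "robust_lp_bound \<kappa>l \<kappa>u \<psi>l \<psi>u cap (ItemLower i) = - \<psi>l $ i"
| "robust_lp_bound \<kappa>l \<kappa>u \<psi>l \<psi>u cap (ItemUpper i) = \<psi>u $ i"
| "robust_lp_bound \<kappa>l \<kappa>u \<psi>l \<psi>u cap (GroupLevel g) = 0"
| "robust_lp_bound \<kappa>l \<kappa>u \<psi>l \<psi>u cap (DualFeasible g p) = 0"
| "robust_lp_bound \<kappa>l \<kappa>u \<psi>l \<psi>u cap (DualNonneg g k) = 0"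

definition robust_lp_matrix ::
    "('g \<Rightarrow> 'n set) \<Rightarrow> real^('n \<times> 'm)^'k \<Rightarrow> real^'k
      \<Rightarrow> real^(('n \<times> 'm, 'g, 'k) lp_var)^(('n::finite, 'm::finite, 'g::finite, 'k::finite) lp_row)"
  where
  "robust_lp_matrix G Q e = (\<chi> r x. robust_lp_coeff G Q e r x)"

definition robust_lp_rhs ::
    "real^'n \<Rightarrow> real^'n \<Rightarrow> real^'m \<Rightarrow> real^'m \<Rightarrow> real^('n \<times> 'm)
      \<Rightarrow> real^(('n::finite, 'm::finite, 'g::finite, 'k::finite) lp_row)" where
  "robust_lp_rhs \<kappa>l \<kappa>u \<psi>l \<psi>u cap = (\<chi> r. robust_lp_bound \<kappa>l \<kappa>u \<psi>l \<psi>u cap r)"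

definition robust_lp_objective :: "real^(('p::finite, 'g::finite, 'k::finite) lp_var)" where
  "robust_lp_objective = axis Level 1"

definition alloc_part :: "real^(('p::finite, 'g::finite, 'k::finite) lp_var) \<Rightarrow> real^'p" where
  "alloc_part x = (\<chi> p. x $ Alloc p)"

end

(*
  Since 0 <= a, linear programming duality makes "the worst case over V of group g is at least t"
  equivalent to the existence of a dual feasible y g with t <= e . y g, even when V is empty. The
  feasible points of the linear program therefore project onto the hypograph of the worst-case
  welfare, which gives equality of values and, for V nonempty, of optimizers. Duality and the
  attainment of optima both rest on one fact: a linear image of the nonnegative orthant is a finitely
  generated, hence closed, convex cone.
*)
theory Submission
  imports Defs
begin

section \<open>Finitely generated cones and the coordinatewise order\<close>

lemma nonneg_orthant_eq_convex_cone_hull: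
  "{x :: 'a::euclidean_space. \<forall>i\<in>Basis. 0 \<le> x \<bullet> i} = convex_cone hull Basis"
proof
  show "{x :: 'a. \<forall>i\<in>Basis. 0 \<le> x \<bullet> i} \<subseteq> convex_cone hull Basis"
  proof
    fix x :: 'a assume x: "x \<in> {x. \<forall>i\<in>Basis. 0 \<le> x \<bullet> i}"
    have "(\<Sum>i\<in>B. (x \<bullet> i) *\<^sub>R i) \<in> convex_cone hull Basis" if "B \<subseteq> Basis" for B :: "'a set"
      using finite_subset[OF that finite_Basis] that x
      by (induction rule: finite_induct)
        (auto intro!: convex_cone_hull_add convex_cone_hull_mul convex_cone_hull_contains_0 intro: hull_inc)
    from this[of Basis] show "x \<in> convex_cone hull Basis"
      by (simp add: euclidean_representation)
  qed
  show "convex_cone hull Basis \<subseteq> {x :: 'a. \<forall>i\<in>Basis. 0 \<le> x \<bullet> i}"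
    by (rule hull_minimal) (auto simp: convex_cone_iff inner_add_left inner_not_same_Basis inner_Basis)
qed

text \<open>A linear image of a closed cone need not be closed. This one is generated by the images
  of the finitely many basis vectors, and finite generation gives closedness.\<close>

lemma nonneg_orthant_image:
  fixes L :: "'a::euclidean_space \<Rightarrow> 'b::euclidean_space"
  assumes "linear L"
  shows "closed (L ` {x. \<forall>i\<in>Basis. 0 \<le> x \<bullet> i})" "convex_cone (L ` {x. \<forall>i\<in>Basis. 0 \<le> x \<bullet> i})"
proof -
  have *: "L ` {x. \<forall>i\<in>Basis. 0 \<le> x \<bullet> i} = convex_cone hull (L ` Basis)"
    by (simp add: nonneg_orthant_eq_convex_cone_hull convex_cone_hull_linear_image assms)
  show "closed (L ` {x. \<forall>i\<in>Basis. 0 \<le> x \<bullet> i})"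
    by (simp add: * closed_convex_cone_hull)
  show "convex_cone (L ` {x. \<forall>i\<in>Basis. 0 \<le> x \<bullet> i})"
    by (simp add: * convex_cone_convex_cone_hull)
qed

text \<open>Stating the orthant through \<open>Basis\<close> covers tuples of vectors and reals in
  one form; this lemma and the next translate it back, factor by factor.\<close>

lemma Basis_nonneg_vec: "(\<forall>i\<in>Basis. 0 \<le> x \<bullet> i) \<longleftrightarrow> 0 \<le> x" for x :: "real^'n"
  by (auto simp: Basis_vec_def inner_axis less_eq_vec_def)

lemma Basis_nonneg_Pair:
  "(\<forall>i\<in>Basis. 0 \<le> (x, y) \<bullet> i) \<longleftrightarrow> (\<forall>i\<in>Basis. 0 \<le> x \<bullet> i) \<and> (\<forall>i\<in>Basis. 0 \<le> y \<bullet> i)"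
  by (simp add: Basis_prod_def ball_Un)

lemma axis_nonneg: "0 \<le> axis i (1 :: real)"
  by (simp add: less_eq_vec_def axis_def)

lemma inner_nonneg_vec: "0 \<le> x \<Longrightarrow> 0 \<le> y \<Longrightarrow> 0 \<le> x \<bullet> y" for x y :: "real^'n"
  by (simp add: inner_vec_def less_eq_vec_def sum_nonneg)

lemma inner_mono_vec: "0 \<le> z \<Longrightarrow> x \<le> y \<Longrightarrow> z \<bullet> x \<le> z \<bullet> y" for x y z :: "real^'n"
  using inner_nonneg_vec[of z "y - x"] by (simp add: inner_diff_right)

section \<open>Separation, linear programming duality and attainment of optima\<close>

lemma convex_cone_separation:
  fixes K :: "'a::euclidean_space set"
  assumes "closed K" "convex_cone K" "z \<notin> K"
  obtains h where "h \<bullet> z < 0" "\<And>x. x \<in> K \<Longrightarrow> 0 \<le> h \<bullet> x"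
proof -
  obtain h \<beta> where h: "h \<bullet> z < \<beta>" "\<And>x. x \<in> K \<Longrightarrow> \<beta> < h \<bullet> x"
    using separating_hyperplane_closed_point[of K z] assms by (auto simp: convex_cone_def)
  have "\<beta> < 0"
    using h(2)[of 0] assms by (simp add: convex_cone_contains_0)
  moreover have "0 \<le> h \<bullet> x" if "x \<in> K" for x
  proof (rule ccontr)
    assume "\<not> 0 \<le> h \<bullet> x"
    \<comment> \<open>Both \<open>\<beta>\<close> and \<open>h \<bullet> x\<close> are negative, so
      the factor is positive. The scaled point has inner product exactly \<open>\<beta>\<close> with
      \<open>h\<close>, against the strict separation.\<close>
    moreover have "(\<beta> / (h \<bullet> x)) *\<^sub>R x \<in> K"
      using \<open>\<beta> < 0\<close> calculation that assms by (intro convex_cone_scaleR) (auto intro: divide_nonpos_neg)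
    ultimately show False
      using h(2) by fastforce
  qed
  ultimately show thesis
    using h(1) that[of h] by fastforce
qed

text \<open>
  Since \<open>0 \<le> d\<close>, no feasibility assumption on the primal is needed: a recession direction \<open>v \<ge> 0\<close>
  with \<open>Q *v v \<ge> 0\<close> cannot have \<open>d \<bullet> v < 0\<close>. If the primal is infeasible, the dual is unbounded.
\<close>

lemma lp_duality:
  fixes Q :: "real^'p^'k" and e :: "real^'k"
  assumes d: "0 \<le> d"
  shows "(\<forall>v. e \<le> Q *v v \<and> 0 \<le> v \<longrightarrow> t \<le> d \<bullet> v) \<longleftrightarrow> (\<exists>y. 0 \<le> y \<and> y v* Q \<le> d \<and> t \<le> e \<bullet> y)"
proof
  assume "\<exists>y. 0 \<le> y \<and> y v* Q \<le> d \<and> t \<le> e \<bullet> y"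
  then obtain y where y: "0 \<le> y" "y v* Q \<le> d" "t \<le> e \<bullet> y" by blast
  show "\<forall>v. e \<le> Q *v v \<and> 0 \<le> v \<longrightarrow> t \<le> d \<bullet> v"
  proof safe
    fix v assume v: "e \<le> Q *v v" "0 \<le> v"
    have "t \<le> y \<bullet> e" using y by (simp add: inner_commute)
    also have "\<dots> \<le> y \<bullet> (Q *v v)" using y v by (intro inner_mono_vec)
    also have "\<dots> = v \<bullet> (y v* Q)" by (metis dot_lmul_matrix inner_commute)
    also have "\<dots> \<le> v \<bullet> d" using y v by (intro inner_mono_vec)
    finally show "t \<le> d \<bullet> v" by (simp add: inner_commute)
  qed
next
  assume bound: "\<forall>v. e \<le> Q *v v \<and> 0 \<le> v \<longrightarrow> t \<le> d \<bullet> v"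
  \<comment> \<open>\<open>s\<close> is the slack in \<open>y v* Q \<le> d\<close> and
    \<open>r\<close> the slack in \<open>t \<le> e \<bullet> y\<close>, so \<open>(d, t)\<close>
    lies in the image of the orthant exactly when a suitable dual vector exists.\<close>
  define L :: "(real^'k) \<times> (real^'p) \<times> real \<Rightarrow> (real^'p) \<times> real"
    where "L = (\<lambda>(y, s, r). (y v* Q + s, e \<bullet> y - r))"
  have "linear L"
    by (rule linearI) (auto simp: L_def vector_matrix_left_distrib scaleR_vector_matrix_assoc
        inner_add_right algebra_simps)
  note cone = nonneg_orthant_image[OF this]
  define K where "K = L ` {x. \<forall>i\<in>Basis. 0 \<le> x \<bullet> i}"
  have K: "(y v* Q + s, e \<bullet> y - r) \<in> K" if "0 \<le> y" "0 \<le> s" "0 \<le> r" for y s r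
    unfolding K_def using that
    by (intro image_eqI[of _ _ "(y, s, r)"]) (auto simp: L_def Basis_nonneg_Pair Basis_nonneg_vec)
  have "(d, t) \<in> K"
  proof (rule ccontr)
    assume "(d, t) \<notin> K"
    then obtain h where h: "h \<bullet> (d, t) < 0" "\<And>x. x \<in> K \<Longrightarrow> 0 \<le> h \<bullet> x"
      using convex_cone_separation[OF cone[folded K_def]] by blast
    define v w where "v = fst h" and "w = - snd h"
    then have vw: "h = (v, - w)" by simp
    have neg: "d \<bullet> v < t * w"
      using h(1) by (simp add: vw inner_commute)
    have pos: "0 \<le> v \<bullet> (y v* Q + s) - w * (e \<bullet> y - r)" if "0 \<le> y" "0 \<le> s" "0 \<le> r" for y s r
      using h(2)[OF K[OF that]] by (simp add: vw)
    \<comment> \<open>Testing the separating functional on generators of the cone: the slack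
      \<open>r\<close> gives the sign of \<open>w\<close>, the slacks \<open>s\<close> that of
      \<open>v\<close>, and the unit vectors \<open>y\<close> the rows of \<open>Qv\<close>.\<close>
    have w: "0 \<le> w"
      using pos[of 0 0 1] by simp
    have v: "0 \<le> v"
    proof (unfold less_eq_vec_def, safe)
      fix p
      show "0 $ p \<le> v $ p"
        using pos[OF order_refl axis_nonneg[of p] order_refl] by (simp add: inner_axis)
    qed
    have Qv: "w *\<^sub>R e \<le> Q *v v"
    proof (unfold less_eq_vec_def, safe)
      fix k
      have "v \<bullet> (axis k 1 v* Q) = (Q *v v) $ k"
        using dot_lmul_matrix[of "axis k 1" Q v] by (simp add: inner_commute[of v] inner_axis')
      then show "(w *\<^sub>R e) $ k \<le> (Q *v v) $ k"
        using pos[OF axis_nonneg[of k] order_refl order_refl] by (simp add: inner_axis)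
    qed
    \<comment> \<open>If \<open>w\<close> is positive, dividing \<open>v\<close> by it gives a
      primal feasible point of value below \<open>t\<close>. If \<open>w\<close> is zero,
      \<open>neg\<close> says that \<open>d \<bullet> v\<close> is negative, which the signs of
      \<open>d\<close> and \<open>v\<close> exclude.\<close>
    show False
    proof (cases "w = 0")
      case True
      then show False
        using neg inner_nonneg_vec[OF d v] by simp
    next
      case False
      with w have "0 < w" by simp
      have "e \<le> Q *v (inverse w *\<^sub>R v)"
        using Qv \<open>0 < w\<close> by (auto simp: matrix_vector_mult_scaleR less_eq_vec_def field_simps)
      moreover have "0 \<le> inverse w *\<^sub>R v"
        using v \<open>0 < w\<close> by (auto simp: less_eq_vec_def)
      ultimately have "t \<le> d \<bullet> (inverse w *\<^sub>R v)"
        using bound by blast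
      then show False
        using neg \<open>0 < w\<close> by (simp add: field_simps)
    qed
  qed
  then obtain y s r where "0 \<le> y" "0 \<le> s" "0 \<le> r" "d = y v* Q + s" "t = e \<bullet> y - r"
    by (auto simp: K_def L_def Basis_nonneg_Pair Basis_nonneg_vec)
  then show "\<exists>y. 0 \<le> y \<and> y v* Q \<le> d \<and> t \<le> e \<bullet> y"
    by (intro exI[of _ y]) (auto simp: less_eq_vec_def)
qed

text \<open>
  The pairs of a right-hand side and an objective value attainable for it (or any smaller value)
  form a closed cone; \<open>T\<close> is its section at \<open>b\<close>. The free variable \<open>x\<close> is split as \<open>u - w\<close>.
\<close>

lemma lp_optimal_exists:
  assumes ne: "lp_feasible M b \<noteq> {}" and bdd: "\<And>x. x \<in> lp_feasible M b \<Longrightarrow> c \<bullet> x \<le> B"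
  shows "\<exists>x. lp_optimal c M b x"
proof -
  define T where "T = {t. \<exists>x\<in>lp_feasible M b. t \<le> c \<bullet> x}"
  \<comment> \<open>\<open>s\<close> is the slack of the constraints and \<open>r\<close> the amount
    by which the recorded value falls short of the objective.\<close>
  define L :: "(real^'a) \<times> (real^'a) \<times> (real^'b) \<times> real \<Rightarrow> (real^'b) \<times> real"
    where "L = (\<lambda>(u, w, s, r). (M *v (u - w) + s, c \<bullet> (u - w) - r))"
  have "linear L"
    by (rule linearI) (auto simp: L_def matrix_vector_right_distrib matrix_vector_mult_diff_distrib
        matrix_vector_mult_scaleR inner_add_right inner_diff_right algebra_simps)
  then have "closed (L ` {x. \<forall>i\<in>Basis. 0 \<le> x \<bullet> i})"
    by (rule nonneg_orthant_image)
  moreover have "T = Pair b -` (L ` {x. \<forall>i\<in>Basis. 0 \<le> x \<bullet> i})"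
  proof (intro equalityI subsetI)
    fix t assume "t \<in> T"
    then obtain x where x: "M *v x \<le> b" "t \<le> c \<bullet> x"
      by (auto simp: T_def lp_feasible_def)
    define u where "u = (\<chi> i. max 0 (x $ i))"
    define w where "w = (\<chi> i. max 0 (- x $ i))"
    have uw: "u - w = x"
      by (simp add: u_def w_def vec_eq_iff max_def)
    have "0 \<le> u" "0 \<le> w"
      by (simp_all add: u_def w_def less_eq_vec_def)
    then show "t \<in> Pair b -` (L ` {x. \<forall>i\<in>Basis. 0 \<le> x \<bullet> i})"
      using x by (intro vimageI2 image_eqI[of _ _ "(u, w, b - M *v x, c \<bullet> x - t)"])
        (auto simp: L_def Basis_nonneg_Pair Basis_nonneg_vec uw)
  next
    fix t assume "t \<in> Pair b -` (L ` {x. \<forall>i\<in>Basis. 0 \<le> x \<bullet> i})"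
    then obtain u w s r where "b = M *v (u - w) + s" "t = c \<bullet> (u - w) - r" "0 \<le> s" "0 \<le> r"
      by (auto simp: L_def Basis_nonneg_Pair Basis_nonneg_vec)
    then show "t \<in> T"
      unfolding T_def lp_feasible_def by (intro CollectI bexI[of _ "u - w"]) (auto simp: less_eq_vec_def)
  qed
  ultimately have "closed T"
    by (simp add: closed_vimage continuous_on_Pair)
  moreover have "T \<noteq> {}" using ne by (auto simp: T_def)
  moreover have bT: "bdd_above T"
    by (rule bdd_aboveI[of _ B]) (auto simp: T_def intro: order_trans[OF _ bdd])
  \<comment> \<open>A closed set that is nonempty and bounded above contains its supremum; a
    feasible point witnessing this membership is optimal.\<close>
  ultimately have "Sup T \<in> T" by (simp add: closed_contains_Sup)
  then obtain x where x: "x \<in> lp_feasible M b" "Sup T \<le> c \<bullet> x" by (auto simp: T_def)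
  have "c \<bullet> x' \<le> Sup T" if "x' \<in> lp_feasible M b" for x'
    using that bT by (intro cSup_upper) (auto simp: T_def)
  then show ?thesis
    using x by (force simp: lp_optimal_def)
qed

section \<open>Worst-case welfare of a fixed allocation\<close>

lemma linear_uncertainty_set_eq_lp_feasible:
  "linear_uncertainty_set Q e =
     lp_feasible (\<chi> r. case r of Inl k \<Rightarrow> - (Q $ k) | Inr p \<Rightarrow> - axis p 1)
       (\<chi> r. case r of Inl k \<Rightarrow> - (e $ k) | Inr p \<Rightarrow> 0)"
  by (auto simp: linear_uncertainty_set_def lp_feasible_def less_eq_vec_def matrix_vector_mul_component
      inner_axis' split: sum.split)

text \<open>Extending by zero outside \<open>S\<close> turns a group's utility into a linear
  functional of the whole valuation vector. The inner problem thus keeps the full \<open>v\<close>,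
  whose coordinates the rows of \<open>Q\<close> may couple across groups.\<close>

definition mask :: "'n set \<Rightarrow> real^('n \<times> 'm) \<Rightarrow> real^('n::finite \<times> 'm::finite)" where
  "mask S a = (\<chi> p. if fst p \<in> S then a $ p else 0)"

lemma group_utility_eq: "group_utility S a v = mask S a \<bullet> v"
proof -
  have "mask S a \<bullet> v = (\<Sum>p\<in>UNIV. if p \<in> S \<times> UNIV then a $ p * v $ p else 0)"
    by (auto simp: mask_def inner_vec_def mem_Times_iff intro!: sum.cong)
  then show ?thesis
    by (simp add: group_utility_def block_def sum.If_cases)
qed

lemma mask_nonneg: "0 \<le> a \<Longrightarrow> 0 \<le> mask S a"
  by (auto simp: mask_def less_eq_vec_def)

lemma mask_le: "0 \<le> a \<Longrightarrow> mask S a \<le> a"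
  by (auto simp: mask_def less_eq_vec_def)

text \<open>A lower bound on an iterated infimum is a lower bound for each group separately, so
  duality applies group by group with objective \<open>mask (G g) a\<close>.\<close>

lemma worst_case_welfare_ge_iff:
  assumes "0 \<le> a"
  shows "ereal t \<le> worst_case_welfare G (linear_uncertainty_set Q e) a \<longleftrightarrow>
    (\<forall>g. \<exists>y. 0 \<le> y \<and> y v* Q \<le> mask (G g) a \<and> t \<le> e \<bullet> y)"
  unfolding lp_duality[OF mask_nonneg[OF assms], symmetric]
  by (auto simp: worst_case_welfare_def le_INF_iff group_utility_eq linear_uncertainty_set_def)

text \<open>Allocations and valuations are nonnegative, so each group's utility is bounded below by
  0 on \<open>V\<close> and its minimum is attained. Among the finitely many group minima, a
  smallest one is the worst case.\<close>

lemma worst_case_welfare_attained: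
  fixes G :: "'g::finite \<Rightarrow> 'n::finite set" and Q :: "real^('n \<times> 'm::finite)^'k::finite"
  assumes "0 \<le> a" and V: "V = linear_uncertainty_set Q e" "V \<noteq> {}"
  shows "\<exists>v\<in>V. \<exists>g. worst_case_welfare G V a = ereal (group_utility (G g) a v)"
proof -
  obtain M :: "real^('n \<times> 'm)^('k + 'n \<times> 'm)" and b where lp: "V = lp_feasible M b"
    using V linear_uncertainty_set_eq_lp_feasible by blast
  have min: "\<exists>v\<in>V. \<forall>v'\<in>V. mask (G g) a \<bullet> v \<le> mask (G g) a \<bullet> v'" for g
  proof -
    \<comment> \<open>Attainment is available for maximization, hence the negated objective.\<close>
    have "\<exists>v. lp_optimal (- mask (G g) a) M b v"
    proof (rule lp_optimal_exists)
      show "lp_feasible M b \<noteq> {}"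
        using V lp by simp
      fix v assume "v \<in> lp_feasible M b"
      then have "0 \<le> v"
        using V lp by (auto simp: linear_uncertainty_set_def)
      then show "- mask (G g) a \<bullet> v \<le> 0"
        using inner_nonneg_vec[OF mask_nonneg[OF \<open>0 \<le> a\<close>]] by simp
    qed
    then show ?thesis
      by (auto simp: lp lp_optimal_def)
  qed
  obtain v where v: "\<And>g. v g \<in> V" "\<And>g v'. v' \<in> V \<Longrightarrow> mask (G g) a \<bullet> v g \<le> mask (G g) a \<bullet> v'"
    using min by metis
  obtain g where g: "\<And>g'. mask (G g) a \<bullet> v g \<le> mask (G g') a \<bullet> v g'"
    using ex_is_arg_min_if_finite[of UNIV "\<lambda>g. mask (G g) a \<bullet> v g"] by (auto simp: is_arg_min_linorder)
  have "worst_case_welfare G V a = ereal (group_utility (G g) a (v g))"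
    unfolding worst_case_welfare_def group_utility_eq
  proof (rule antisym)
    show "(INF v\<in>V. INF g. ereal (mask (G g) a \<bullet> v)) \<le> ereal (mask (G g) a \<bullet> v g)"
      by (rule INF_lower2[OF v(1)], rule INF_lower) simp
    show "ereal (mask (G g) a \<bullet> v g) \<le> (INF v\<in>V. INF g. ereal (mask (G g) a \<bullet> v))"
      using order_trans[OF g v(2)] by (intro INF_greatest) simp
  qed
  then show ?thesis
    using v(1) by blast
qed

section \<open>Evaluating the rows of the linear program\<close>

lemma sum_lp_var:
  fixes f :: "('p::finite, 'g::finite, 'k::finite) lp_var \<Rightarrow> real"
  shows "(\<Sum>x\<in>UNIV. f x) = (\<Sum>p\<in>UNIV. f (Alloc p)) + f Level + (\<Sum>g\<in>UNIV. \<Sum>k\<in>UNIV. f (Dual g k))"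
proof -
  have "(UNIV :: ('p, 'g, 'k) lp_var set) = range Alloc \<union> {Level} \<union> range (case_prod Dual)"
    by (auto simp: image_iff) (metis lp_var.exhaust)
  then have "(\<Sum>x\<in>UNIV. f x) = (\<Sum>x\<in>range Alloc \<union> {Level} \<union> range (case_prod Dual). f x)"
    by simp
  also have "\<dots> = (\<Sum>x\<in>range Alloc. f x) + f Level + (\<Sum>x\<in>range (case_prod Dual). f x)"
    by (subst sum.union_disjoint) (auto simp: image_iff add.commute)
  also have "\<dots> = (\<Sum>p\<in>UNIV. f (Alloc p)) + f Level + (\<Sum>(g, k)\<in>UNIV. f (Dual g k))"
    by (subst (1 2) sum.reindex) (auto simp: inj_def case_prod_unfold)
  finally show ?thesis
    by (simp add: sum.cartesian_product)
qed

definition dual_part :: "'g \<Rightarrow> real^(('p::finite, 'g::finite, 'k::finite) lp_var) \<Rightarrow> real^'k" where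
  "dual_part g x = (\<chi> k. x $ Dual g k)"

text \<open>Used to split the single vector inequality of the program into its nine families of
  constraints.\<close>

lemma all_lp_row:
  "(\<forall>r. P r) \<longleftrightarrow> (\<forall>p. P (AllocNonneg p)) \<and> (\<forall>p. P (AllocCap p)) \<and> (\<forall>j. P (AgentLower j)) \<and>
    (\<forall>j. P (AgentUpper j)) \<and> (\<forall>i. P (ItemLower i)) \<and> (\<forall>i. P (ItemUpper i)) \<and>
    (\<forall>g. P (GroupLevel g)) \<and> (\<forall>g p. P (DualFeasible g p)) \<and> (\<forall>g k. P (DualNonneg g k))"
  (is "?L \<longleftrightarrow> ?R")
proof
  assume ?R
  show ?L
  proof
    fix r
    show "P r"
      using \<open>?R\<close> by (cases r) blast+
  qed
qed blast

text \<open>The coefficients of an agent row are the indicator of that agent's allocation variables;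
  this collapses the row to the agent's total. The next two lemmas serve item totals and single
  entries.\<close>

lemma sum_of_bool_fst:
  fixes f :: "'a::finite \<times> 'b::finite \<Rightarrow> real"
  shows "(\<Sum>p\<in>UNIV. of_bool (\<exists>i. p = (j, i)) * f p) = (\<Sum>i\<in>UNIV. f (j, i))"
proof -
  have "(\<Sum>p\<in>UNIV. of_bool (\<exists>i. p = (j, i)) * f p) = (\<Sum>p\<in>range (Pair j). f p)"
    by (rule sum.mono_neutral_cong_right) auto
  then show ?thesis
    by (simp add: sum.reindex inj_def)
qed

lemma sum_of_bool_snd:
  fixes f :: "'a::finite \<times> 'b::finite \<Rightarrow> real"
  shows "(\<Sum>p\<in>UNIV. of_bool (\<exists>j. p = (j, i)) * f p) = (\<Sum>j\<in>UNIV. f (j, i))"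
proof -
  have "(\<Sum>p\<in>UNIV. of_bool (\<exists>j. p = (j, i)) * f p) = (\<Sum>p\<in>range (\<lambda>j. (j, i)). f p)"
    by (rule sum.mono_neutral_cong_right) auto
  then show ?thesis
    by (simp add: sum.reindex inj_def)
qed

lemma sum_of_bool_eq:
  fixes f :: "'a::finite \<Rightarrow> real"
  shows "(\<Sum>p\<in>UNIV. of_bool (p = q) * f p) = f q"
  by (simp add: of_bool_def if_distrib[of "\<lambda>x. x * _"] cong: if_cong)

text \<open>The matrix coefficients are unfolded only here; later arguments work with an allocation,
  a level and one dual vector per group.\<close>

lemma lp_feasible_robust_lp_iff:
  fixes G :: "'g::finite \<Rightarrow> 'n::finite set" and Q :: "real^('n \<times> 'm::finite)^'k::finite"
  shows "x \<in> lp_feasible (robust_lp_matrix G Q e) (robust_lp_rhs \<kappa>l \<kappa>u \<psi>l \<psi>u cap) \<longleftrightarrow>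
     alloc_part x \<in> feasible_allocations \<kappa>l \<kappa>u \<psi>l \<psi>u cap \<and>
     (\<forall>g. 0 \<le> dual_part g x \<and> dual_part g x v* Q \<le> mask (G g) (alloc_part x) \<and>
        x $ Level \<le> e \<bullet> dual_part g x)"
proof -
  \<comment> \<open>The rows of group \<open>g\<close> involve no other group's dual vector, so the
    double sum over dual variables reduces to the block of \<open>g\<close>.\<close>
  have group_sum: "(\<Sum>g'\<in>UNIV. \<Sum>k\<in>UNIV. of_bool (g' = g) * F g' k) = (\<Sum>k\<in>UNIV. F g k)"
    for g :: 'g and F :: "'g \<Rightarrow> 'k \<Rightarrow> real"
    by (simp add: sum_distrib_left[symmetric] sum_of_bool_eq)
  have rows:
    "(\<Sum>z\<in>UNIV. robust_lp_coeff G Q e (AllocNonneg p) z * x $ z) = - alloc_part x $ p"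
    "(\<Sum>z\<in>UNIV. robust_lp_coeff G Q e (AllocCap p) z * x $ z) = alloc_part x $ p"
    "(\<Sum>z\<in>UNIV. robust_lp_coeff G Q e (AgentLower j) z * x $ z) = - (\<Sum>i\<in>UNIV. alloc_part x $ (j, i))"
    "(\<Sum>z\<in>UNIV. robust_lp_coeff G Q e (AgentUpper j) z * x $ z) = (\<Sum>i\<in>UNIV. alloc_part x $ (j, i))"
    "(\<Sum>z\<in>UNIV. robust_lp_coeff G Q e (ItemLower i) z * x $ z) = - (\<Sum>j\<in>UNIV. alloc_part x $ (j, i))"
    "(\<Sum>z\<in>UNIV. robust_lp_coeff G Q e (ItemUpper i) z * x $ z) = (\<Sum>j\<in>UNIV. alloc_part x $ (j, i))"
    "(\<Sum>z\<in>UNIV. robust_lp_coeff G Q e (GroupLevel g) z * x $ z) = x $ Level - e \<bullet> dual_part g x"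
    "(\<Sum>z\<in>UNIV. robust_lp_coeff G Q e (DualFeasible g p) z * x $ z) =
       (dual_part g x v* Q) $ p - mask (G g) (alloc_part x) $ p"
    "(\<Sum>z\<in>UNIV. robust_lp_coeff G Q e (DualNonneg g k) z * x $ z) = - dual_part g x $ k"
    for p i j g k
    subgoal by (simp add: sum_lp_var sum_negf sum_of_bool_eq alloc_part_def)
    subgoal by (simp add: sum_lp_var sum_negf sum_of_bool_eq alloc_part_def)
    subgoal by (simp add: sum_lp_var sum_negf sum_of_bool_fst alloc_part_def)
    subgoal by (simp add: sum_lp_var sum_negf sum_of_bool_fst alloc_part_def)
    subgoal by (simp add: sum_lp_var sum_negf sum_of_bool_snd alloc_part_def)
    subgoal by (simp add: sum_lp_var sum_negf sum_of_bool_snd alloc_part_def)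
    subgoal by (simp add: sum_lp_var sum_negf group_sum mult.assoc inner_vec_def dual_part_def
        del: sum_of_bool_mult_eq sum_mult_of_bool_eq)
    subgoal by (simp add: sum_lp_var sum_negf group_sum mult.assoc vector_matrix_mult_def
        of_bool_conj sum_of_bool_eq mask_def alloc_part_def dual_part_def
        del: sum_of_bool_mult_eq sum_mult_of_bool_eq) (simp add: mult.commute)
    subgoal by (simp add: sum_lp_var sum_negf group_sum mult.assoc of_bool_conj sum_of_bool_eq dual_part_def
        del: sum_of_bool_mult_eq sum_mult_of_bool_eq)
    done
  have "x \<in> lp_feasible (robust_lp_matrix G Q e) (robust_lp_rhs \<kappa>l \<kappa>u \<psi>l \<psi>u cap) \<longleftrightarrow>
    (\<forall>r. (\<Sum>z\<in>UNIV. robust_lp_coeff G Q e r z * x $ z) \<le> robust_lp_bound \<kappa>l \<kappa>u \<psi>l \<psi>u cap r)"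
    by (simp add: lp_feasible_def less_eq_vec_def robust_lp_matrix_def robust_lp_rhs_def
        matrix_vector_mult_def)
  also have "\<dots> \<longleftrightarrow> alloc_part x \<in> feasible_allocations \<kappa>l \<kappa>u \<psi>l \<psi>u cap \<and>
     (\<forall>g. 0 \<le> dual_part g x \<and> dual_part g x v* Q \<le> mask (G g) (alloc_part x) \<and>
        x $ Level \<le> e \<bullet> dual_part g x)"
    unfolding all_lp_row rows
    by (simp add: feasible_allocations_def less_eq_vec_def alloc_part_def dual_part_def mask_def) blast
  finally show ?thesis .
qed

section \<open>Equivalence of the robust problem and the linear program\<close>

theorem corollary3p6:
  fixes G :: "'g::finite \<Rightarrow> 'n::finite set"
    and VG :: "'g \<Rightarrow> ('n \<times> 'm::finite \<Rightarrow> real) set"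
    and V A :: "(real^('n \<times> 'm)) set"
    and Q :: "real^('n \<times> 'm)^'k::finite" and e :: "real^'k"
    and \<kappa>l \<kappa>u :: "real^'n" and \<psi>l \<psi>u :: "real^'m" and cap :: "real^('n \<times> 'm)"
    and M :: "real^(('n \<times> 'm, 'g, 'k) lp_var)^(('n, 'm, 'g, 'k) lp_row)"
    and b :: "real^(('n, 'm, 'g, 'k) lp_row)"
    and c :: "real^(('n \<times> 'm, 'g, 'k) lp_var)"
  assumes groups: "grouping G"
    and uncertainty: "V = linear_uncertainty_set Q e"
    and VG: "\<And>g. VG g \<subseteq> (G g \<times> UNIV) \<rightarrow>\<^sub>E UNIV"
    and independent: "V = product_of_groups G VG"
    and allocations: "A = feasible_allocations \<kappa>l \<kappa>u \<psi>l \<psi>u cap"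
    and M: "M = robust_lp_matrix G Q e"
    and b: "b = robust_lp_rhs \<kappa>l \<kappa>u \<psi>l \<psi>u cap"
    and c: "c = robust_lp_objective"
  shows "(\<forall>a t. (a \<in> A \<and> ereal t \<le> worst_case_welfare G V a) \<longleftrightarrow>
             (\<exists>x\<in>lp_feasible M b. alloc_part x = a \<and> c \<bullet> x = t))
       \<and> robust_value G V A = lp_value c M b
       \<and> (V \<noteq> {} \<longrightarrow>
            (\<forall>a\<in>A. \<exists>v\<in>V. \<exists>g. worst_case_welfare G V a = ereal (group_utility (G g) a v))
          \<and> (A \<noteq> {} \<longrightarrow> (\<exists>x. lp_optimal c M b x))
          \<and> (\<forall>a. robust_optimal G V A a \<longleftrightarrow> (\<exists>x. lp_optimal c M b x \<and> alloc_part x = a)))"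
proof -
  note V = uncertainty
  have nonneg: "0 \<le> a" if "a \<in> A" for a
    using that by (simp add: allocations feasible_allocations_def)
  have c_inner: "c \<bullet> x = x $ Level" for x
    by (simp add: c robust_lp_objective_def inner_axis')
  have feasible: "x \<in> lp_feasible M b \<longleftrightarrow> alloc_part x \<in> A \<and>
      (\<forall>g. 0 \<le> dual_part g x \<and> dual_part g x v* Q \<le> mask (G g) (alloc_part x) \<and>
        x $ Level \<le> e \<bullet> dual_part g x)" for x
    by (simp add: M b allocations lp_feasible_robust_lp_iff)
  have hypograph: "(a \<in> A \<and> ereal t \<le> worst_case_welfare G V a) \<longleftrightarrow>
      (\<exists>x\<in>lp_feasible M b. alloc_part x = a \<and> c \<bullet> x = t)" (is "?L \<longleftrightarrow> ?R") for a t
  proof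
    assume ?L
    then have "\<forall>g. \<exists>y. 0 \<le> y \<and> y v* Q \<le> mask (G g) a \<and> t \<le> e \<bullet> y"
      using worst_case_welfare_ge_iff[OF nonneg, of a] unfolding V by blast
    then obtain y where y: "\<And>g. 0 \<le> y g \<and> y g v* Q \<le> mask (G g) a \<and> t \<le> e \<bullet> y g"
      by metis
    \<comment> \<open>The feasible point is assembled from the allocation, the level and the dual
      certificates chosen for the groups.\<close>
    define x :: "real^(('n \<times> 'm, 'g, 'k) lp_var)"
      where "x = (\<chi> z. case z of Alloc p \<Rightarrow> a $ p | Level \<Rightarrow> t | Dual g k \<Rightarrow> y g $ k)"
    have "alloc_part x = a" "x $ Level = t" "dual_part g x = y g" for g
      by (simp_all add: x_def alloc_part_def dual_part_def)
    then show ?R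
      using \<open>?L\<close> y by (intro bexI[of _ x]) (auto simp: feasible c_inner)
  next
    assume ?R
    then obtain x where x: "x \<in> lp_feasible M b" "alloc_part x = a" "x $ Level = t"
      by (auto simp: c_inner)
    then have "a \<in> A" by (simp add: feasible)
    then show ?L
      using x worst_case_welfare_ge_iff[OF nonneg[of a]] unfolding V feasible by blast
  qed
  have welfare_ge: "ereal (c \<bullet> x) \<le> worst_case_welfare G V (alloc_part x)" "alloc_part x \<in> A"
    if "x \<in> lp_feasible M b" for x
    using hypograph that by blast+
  have values_eq: "robust_value G V A = lp_value c M b"
  proof (rule antisym)
    show "lp_value c M b \<le> robust_value G V A"
      unfolding lp_value_def robust_value_def
      using welfare_ge by (intro SUP_least) (auto intro: SUP_upper2)
    show "robust_value G V A \<le> lp_value c M b"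
      unfolding robust_value_def
    proof (rule SUP_least)
      fix a assume "a \<in> A"
      have *: "ereal t \<le> lp_value c M b" if "ereal t \<le> worst_case_welfare G V a" for t
        using that \<open>a \<in> A\<close> hypograph[of a t] by (auto simp: lp_value_def intro!: SUP_upper2)
      show "worst_case_welfare G V a \<le> lp_value c M b"
        \<comment> \<open>A real welfare is itself taken as \<open>t\<close>. The value
          \<open>\<infinity>\<close>, which arises when \<open>V\<close> is empty, puts every real
          below \<open>lp_value\<close>, so that is infinite too.\<close>
        using * by (cases "worst_case_welfare G V a") (auto intro: ereal_top)
    qed
  qed
  have attained: "\<exists>v\<in>V. \<exists>g. worst_case_welfare G V a = ereal (group_utility (G g) a v)"
    if "V \<noteq> {}" "a \<in> A" for a
    using worst_case_welfare_attained[OF nonneg V] that by blast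
  have real_welfare: "\<exists>t. worst_case_welfare G V a = ereal t" if "V \<noteq> {}" "a \<in> A" for a
    using attained[OF that] by blast
  have optimal: "\<exists>x. lp_optimal c M b x" if "V \<noteq> {}" "A \<noteq> {}"
  proof -
    from that obtain a v where "a \<in> A" and v: "v \<in> V" by blast
    show ?thesis
    proof (rule lp_optimal_exists)
      \<comment> \<open>The welfare of \<open>a\<close> is real, hence an admissible level for
        \<open>a\<close>.\<close>
      from real_welfare[OF \<open>V \<noteq> {}\<close> \<open>a \<in> A\<close>] \<open>a \<in> A\<close> show "lp_feasible M b \<noteq> {}"
        using hypograph by (metis empty_iff order_refl)
      fix x assume "x \<in> lp_feasible M b"
      note x = welfare_ge[OF this]
      have v0: "0 \<le> v"
        using v by (simp add: V linear_uncertainty_set_def)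
      \<comment> \<open>One valuation \<open>v\<close> and one group already bound every level: the
        utility is at most \<open>v \<bullet> cap\<close> because
        \<open>0 \<le> a \<le> cap\<close>. Types are nonempty, so \<open>undefined\<close> denotes
        some group.\<close>
      have "worst_case_welfare G V (alloc_part x) \<le> ereal (group_utility (G undefined) (alloc_part x) v)"
        unfolding worst_case_welfare_def by (rule INF_lower2[OF v INF_lower]) simp
      then have "ereal (c \<bullet> x) \<le> ereal (group_utility (G undefined) (alloc_part x) v)"
        using x(1) by (rule order_trans[rotated])
      then have "c \<bullet> x \<le> v \<bullet> mask (G undefined) (alloc_part x)"
        by (simp add: group_utility_eq inner_commute)
      also have "\<dots> \<le> v \<bullet> cap"
        using mask_le[OF nonneg[OF x(2)]] x(2) v0
        by (intro inner_mono_vec) (auto simp: allocations feasible_allocations_def intro: order_trans)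
      finally show "c \<bullet> x \<le> v \<bullet> cap" .
    qed
  qed
  \<comment> \<open>With \<open>V\<close> nonempty every welfare is a real number and so a level of
    the program. For empty \<open>V\<close> and nonempty \<open>A\<close> all allocations are robust
    optimal with value \<open>\<infinity>\<close>, while the program is unbounded and has no
    optimum.\<close>
  have optimal_iff: "robust_optimal G V A a \<longleftrightarrow> (\<exists>x. lp_optimal c M b x \<and> alloc_part x = a)"
    if "V \<noteq> {}" for a
  proof
    assume a: "robust_optimal G V A a"
    then obtain t where t: "worst_case_welfare G V a = ereal t" "a \<in> A"
      using real_welfare[OF \<open>V \<noteq> {}\<close>] by (auto simp: robust_optimal_def)
    then obtain x where x: "x \<in> lp_feasible M b" "alloc_part x = a" "c \<bullet> x = t"
      using hypograph[of a t] by auto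
    have "c \<bullet> x' \<le> c \<bullet> x" if "x' \<in> lp_feasible M b" for x'
    proof -
      have "ereal (c \<bullet> x') \<le> ereal t"
        using welfare_ge[OF that] a t(1) by (metis robust_optimal_def order_trans)
      then show ?thesis by (simp add: x)
    qed
    then show "\<exists>x. lp_optimal c M b x \<and> alloc_part x = a"
      using x by (auto simp: lp_optimal_def)
  next
    assume "\<exists>x. lp_optimal c M b x \<and> alloc_part x = a"
    then obtain x where x: "x \<in> lp_feasible M b" "alloc_part x = a"
      "\<And>x'. x' \<in> lp_feasible M b \<Longrightarrow> c \<bullet> x' \<le> c \<bullet> x"
      by (auto simp: lp_optimal_def)
    have "worst_case_welfare G V a' \<le> worst_case_welfare G V a" if a': "a' \<in> A" for a'
    proof -
      \<comment> \<open>The welfare of a rival \<open>a'\<close> is an attainable level, hence at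
        most \<open>c \<bullet> x\<close>, which in turn is a lower bound for the welfare of
        \<open>a\<close>.\<close>
      obtain t where t: "worst_case_welfare G V a' = ereal t"
        using real_welfare[OF \<open>V \<noteq> {}\<close> a'] by blast
      then obtain x' where "x' \<in> lp_feasible M b" "c \<bullet> x' = t"
        using hypograph[of a' t] a' by auto
      then have "ereal t \<le> ereal (c \<bullet> x)" using x(3) by auto
      also have "\<dots> \<le> worst_case_welfare G V a" using welfare_ge[OF x(1)] x(2) by simp
      finally show ?thesis by (simp add: t)
    qed
    then show "robust_optimal G V A a"
      using welfare_ge[OF x(1)] x(2) by (auto simp: robust_optimal_def)
  qed
  show ?thesis
    using hypograph values_eq attained optimal optimal_iff by blast
qed

end
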